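(* Let $\alpha\in(0,1)$, $\beta\in(0,1+\alpha)$, and let $\lambda\in\mathbb{C}\setminus\{0\}$ with $\arg(\lambda)\in(-\pi\alpha,\pi\alpha)$. For $v>0$ put $$f_{\alpha,\beta}(v)=\frac{1}{\pi}v^{\alpha-\beta}\,\frac{v^{\alpha}\sin(\beta\pi)+\lambda\sin((\alpha-\beta)\pi)}{v^{2\alpha}-2\lambda v^{\alpha}\cos(\alpha\pi)+\lambda^{2}},$$ $$M_{1}=\int_{0}^{\infty}\frac{v^{2\alpha-\beta}}{v^{2\alpha}-2\lambda v^{\alpha}\cos(\alpha\pi)+\lambda^{2}}\,dv,\qquad M_{2}=\int_{0}^{\infty}\frac{v^{\alpha-\beta}}{v^{2\alpha}-2\lambda v^{\alpha}\cos(\alpha\pi)+\lambda^{2}}\,dv.$$ Then: - if $\beta\in(1,\alpha+1)$, $$\int_{0}^{\infty}f_{\alpha,\beta}(v)\,dv=\frac{\sin(\beta\pi)}{\pi}M_{1}+\frac{\lambda\sin(\pi(\alpha-\beta))}{\pi}M_{2}=-\frac{\lambda^{\frac{1-\beta}{\alpha}}}{\alpha};$$ - if $\beta=1$, $$\int_{0}^{\infty}f_{\alpha,\beta}(v)\,dv=\frac{\sin(\beta\pi)}{\pi}M_{1}+\frac{\lambda\sin(\pi(\alpha-\beta))}{\pi}M_{2}=1-\frac{1}{\alpha},$$ where the term with $\sin(\beta\pi)=0$ is understood to be $0$; - if $\beta=\alpha$, the integral $\int_{0}^{\infty}f_{\alpha,\beta}(v)\,dv$ does not exist (it diverges).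
   Context: Complex powers of $\lambda$ are principal: $\lambda^{s}=\exp(s\,\mathrm{Log}\,\lambda)$ with $\arg\lambda\in(-\pi,\pi]$. Integrals over $(0,\infty)$ are (possibly improper) integrals of complex-valued functions of the real variable $v$. *)

theory Defs
  imports "HOL-Analysis.Analysis"
begin

text \<open>
  Integrals over \<open>(0, \<infinity>)\<close> are Henstock--Kurzweil integrals on \<^term>\<open>{0<..} :: real set\<close>: this
  notion covers absolutely convergent as well as (conditionally convergent) improper integrals, so
  that \<^const>\<open>integrable_on\<close> expresses existence of the possibly improper integral. The principal
  branch is that of \<^const>\<open>Arg\<close> and of complex \<^const>\<open>powr\<close>; powers of \<open>v\<close> are real powers.
\<close>

definition denom :: "real \<Rightarrow> complex \<Rightarrow> real \<Rightarrow> complex" where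
  "denom \<alpha> lam v =
     complex_of_real (v powr (2 * \<alpha>))
     - 2 * lam * complex_of_real (v powr \<alpha>) * complex_of_real (cos (\<alpha> * pi)) + lam\<^sup>2"

definition f_fun :: "real \<Rightarrow> real \<Rightarrow> complex \<Rightarrow> real \<Rightarrow> complex" where
  "f_fun \<alpha> \<beta> lam v =
     complex_of_real (1 / pi) * complex_of_real (v powr (\<alpha> - \<beta>)) *
     ((complex_of_real (v powr \<alpha>) * complex_of_real (sin (\<beta> * pi))
        + lam * complex_of_real (sin ((\<alpha> - \<beta>) * pi))) / denom \<alpha> lam v)"

definition M1_integrand :: "real \<Rightarrow> real \<Rightarrow> complex \<Rightarrow> real \<Rightarrow> complex" where
  "M1_integrand \<alpha> \<beta> lam v = complex_of_real (v powr (2 * \<alpha> - \<beta>)) / denom \<alpha> lam v"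

definition M2_integrand :: "real \<Rightarrow> real \<Rightarrow> complex \<Rightarrow> real \<Rightarrow> complex" where
  "M2_integrand \<alpha> \<beta> lam v = complex_of_real (v powr (\<alpha> - \<beta>)) / denom \<alpha> lam v"

text \<open>
  For \<open>\<beta> = 1\<close> the integral defining \<open>M1\<close> diverges. The product of the factor \<open>sin (\<beta> * pi) = 0\<close>
  with \<open>M1\<close> is then \<open>0\<close> whatever value \<^const>\<open>integral\<close> assigns to a non-integrable function, which
  is the convention that this term is understood to be \<open>0\<close>.
\<close>

definition M1 :: "real \<Rightarrow> real \<Rightarrow> complex \<Rightarrow> complex" where
  "M1 \<alpha> \<beta> lam = integral {0<..} (M1_integrand \<alpha> \<beta> lam)"

definition M2 :: "real \<Rightarrow> real \<Rightarrow> complex \<Rightarrow> complex" where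
  "M2 \<alpha> \<beta> lam = integral {0<..} (M2_integrand \<alpha> \<beta> lam)"

end

theory Submission
  imports Defs "HOL-Complex_Analysis.Complex_Analysis" "HOL-Real_Asymp.Real_Asymp"
begin

text \<open>
  With \<open>y = pi * (\<alpha> - 1)\<close> the denominator factors as
  \<open>(v powr \<alpha> + lam * cis y) * (v powr \<alpha> + lam * cis (- y))\<close>, and the condition on \<open>Arg lam\<close>
  keeps both constants \<open>z = lam * cis (\<plusminus> y)\<close> off the closed negative axis. For \<open>\<beta> = 1 + \<alpha> * c\<close> with
  \<open>0 < c < 1\<close>, partial fractions reduce everything to the integrals of
  \<open>v powr (\<alpha> - \<beta>) / (v powr \<alpha> + z)\<close>. These equal \<open>pi / (\<alpha> * sin (pi * c)) * z powr (- c)\<close>: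
  for \<open>z = 1\<close> this is a Beta integral and the reflection formula, and the ray of integration can be
  rotated because \<open>exp ((1 - c) * w) / (1 + exp w)\<close> has a primitive on the strip \<open>\<bar>Im w\<bar> < pi\<close> and
  decays at both ends. For \<open>\<beta> = 1\<close> the difference of the logarithms of the two factors is an explicit
  antiderivative. For \<open>\<beta> = \<alpha>\<close> the integrand is asymptotic to
  \<open>sin (pi * \<alpha>) / pi * v powr (- \<alpha>)\<close>, which is not integrable at infinity.
\<close>

section \<open>Integrals over the half line from limits of a primitive\<close>

text \<open>For a nonnegative integrand, finite limits of the primitive at both ends already force
  absolute integrability. The limits are restated at the extended real endpoints 0 and infinity,
  where the interval form of the fundamental theorem lives. Lebesgue integrability is kept as a
  separate conclusion so that such functions can serve as majorants.\<close>

lemma FTC_Ioi_nonneg: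
  fixes f F :: "real \<Rightarrow> real"
  assumes deriv: "\<And>x. 0 < x \<Longrightarrow> (F has_real_derivative f x) (at x)"
    and cont: "continuous_on {0<..} f"
    and nonneg: "\<And>x. 0 < x \<Longrightarrow> 0 \<le> f x"
    and A: "(F \<longlongrightarrow> A) (at_right 0)" and B: "(F \<longlongrightarrow> B) at_top"
  shows "set_integrable lborel {0<..} f" and "(f has_integral (B - A)) {0<..}"
proof -
  have at0: "((F \<circ> real_of_ereal) \<longlongrightarrow> A) (at_right 0)"
    using A unfolding zero_ereal_def by (simp add: ereal_tendsto_simps)
  have atoo: "((F \<circ> real_of_ereal) \<longlongrightarrow> B) (at_left \<infinity>)"
    using B by (simp add: ereal_tendsto_simps)
  have c: "isCont f x" if "0 < x" for x
    using cont that by (simp add: continuous_on_eq_continuous_at)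
  note ftc = interval_integral_FTC_nonneg[of 0 \<infinity> F f A B, OF _ _ _ _ at0 atoo]
  show int: "set_integrable lborel {0<..} f"
    using ftc(1) deriv c nonneg by (auto simp: einterval_def greaterThan_def)
  have "(LBINT x=0..\<infinity>. f x) = B - A"
    using ftc(2) deriv c nonneg by auto
  then have "integral {0<..} f = B - A"
    using set_borel_integral_eq_integral(2)[OF int]
    by (simp add: interval_lebesgue_integral_0_infty)
  then show "(f has_integral (B - A)) {0<..}"
    using set_borel_integral_eq_integral(1)[OF int] has_integral_integral by metis
qed

text \<open>For a complex integrand, limits of the primitive do not yield absolute integrability, so
  it is taken from the majorant \<open>g\<close>; the primitive then only supplies the
  value.\<close>

lemma FTC_Ioi_dominated:
  fixes f F :: "real \<Rightarrow> complex" and g :: "real \<Rightarrow> real"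
  assumes deriv: "\<And>x. 0 < x \<Longrightarrow> (F has_vector_derivative f x) (at x)"
    and cont: "continuous_on {0<..} f"
    and g: "set_integrable lborel {0<..} g"
    and dom: "\<And>x. 0 < x \<Longrightarrow> norm (f x) \<le> g x"
    and A: "(F \<longlongrightarrow> A) (at_right 0)" and B: "(F \<longlongrightarrow> B) at_top"
  shows "(f has_integral (B - A)) {0<..}"
proof -
  have at0: "((F \<circ> real_of_ereal) \<longlongrightarrow> A) (at_right 0)"
    using A unfolding zero_ereal_def by (simp add: ereal_tendsto_simps)
  have atoo: "((F \<circ> real_of_ereal) \<longlongrightarrow> B) (at_left \<infinity>)"
    using B by (simp add: ereal_tendsto_simps)
  have c: "isCont f x" if "0 < x" for x
    using cont that by (simp add: continuous_on_eq_continuous_at)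
  have meas: "set_borel_measurable lborel {0<..} f"
    unfolding set_borel_measurable_def
    using borel_measurable_continuous_on_indicator[OF _ cont] by simp
  have "AE x in lborel. x \<in> {0<..} \<longrightarrow> norm (f x) \<le> norm (g x)"
    using dom by (intro AE_I2) (smt (verit) greaterThan_iff real_norm_def)
  then have int: "set_integrable lborel {0<..} f"
    by (rule set_integrable_bound[OF g meas])
  have "(LBINT x=0..\<infinity>. f x) = B - A"
    by (rule interval_integral_FTC_integrable[OF _ _ _ _ at0 atoo])
      (use int deriv c in \<open>auto simp: einterval_def greaterThan_def\<close>)
  then have "integral {0<..} f = B - A"
    using set_borel_integral_eq_integral(2)[OF int]
    by (simp add: interval_lebesgue_integral_0_infty)
  then show ?thesis
    using set_borel_integral_eq_integral(1)[OF int] has_integral_integral by metis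
qed

section \<open>The Beta-type kernel on the positive axis\<close>

lemma has_integral_beta_kernel_real:
  fixes a c :: real
  assumes a: "0 < a" and c: "0 < c" "c < 1"
  defines "g \<equiv> \<lambda>v. v powr (a * (1 - c) - 1) / (v powr a + 1)"
  shows "set_integrable lborel {0<..} g"
    and "(g has_integral pi / (a * sin (pi * c))) {0<..}"
proof -
  \<comment> \<open>The substitution \<open>t = v powr a / (v powr a + 1)\<close> turns the integrand into that of a Beta integral.\<close>
  define b where "b = (\<lambda>t::real. t powr (1 - c - 1) * (1 - t) powr (c - 1))"
  have b: "(b has_integral Beta (1 - c) c) {0..1}"
    unfolding b_def using c by (intro has_integral_Beta_real) auto
  have "complex_of_real (Gamma c * Gamma (1 - c)) = of_real (pi / sin (pi * c))"
    using Gamma_reflection_complex[of "of_real c"]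
    by (simp only: of_real_mult of_real_divide of_real_diff of_real_1
        flip: sin_of_real Gamma_complex_of_real)
  then have beta: "Beta (1 - c) c = pi / sin (pi * c)"
    unfolding of_real_eq_iff by (simp add: Beta_def mult.commute)
  \<comment> \<open>The incomplete Beta integral. Since \<open>b\<close> may blow up at 0 and 1,
    \<open>B\<close> is differentiated only inside the interval, while its continuity up to the
    endpoints gives the two limits of \<open>F\<close>.\<close>
  define B where "B = (\<lambda>x. integral {0..x} b)"
  have contB: "continuous_on {0..1} B"
    unfolding B_def using b by (intro indefinite_integral_continuous_1) auto
  have contb: "continuous_on {0<..<1} b"
    unfolding b_def by (intro continuous_intros) auto
  have derivB: "(B has_real_derivative b x) (at x)" if x: "0 < x" "x < 1" for x
  proof -
    have "continuous (at x within {0..1} - {}) b"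
      using contb x
      by (metis continuous_at_imp_continuous_at_within continuous_on_eq_continuous_at
          greaterThanLessThan_iff open_greaterThanLessThan)
    then have "(B has_vector_derivative b x) (at x within {0..1})"
      unfolding B_def
      using integral_has_vector_derivative_continuous_at[of b 0 1 x "{}"] x has_integral_integrable[OF b]
      by simp
    then show ?thesis
      using x by (simp add: has_real_derivative_iff_has_vector_derivative at_within_Icc_at)
  qed
  define F where "F = (\<lambda>v. B (v powr a / (v powr a + 1)) / a)"
  have derivF: "(F has_real_derivative g v) (at v)" if v: "0 < v" for v
  proof -
    define u where "u = v powr a"
    have u: "0 < u" using v by (simp add: u_def)
    have "((\<lambda>v. v powr a / (v powr a + 1)) has_real_derivative
            (a * v powr (a - 1) / (u + 1)\<^sup>2)) (at v)"
      unfolding u_def using v less_imp_neq[OF add_pos_pos[OF u[unfolded u_def] zero_less_one]]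
      by (auto intro!: derivative_eq_intros simp: field_simps power2_eq_square)
    moreover have "(B has_real_derivative b (u / (u + 1))) (at (v powr a / (v powr a + 1)))"
      using derivB[of "u / (u + 1)"] u by (simp flip: u_def)
    ultimately have "(F has_real_derivative
        (b (u / (u + 1)) * (a * v powr (a - 1) / (u + 1)\<^sup>2) / a)) (at v)"
      unfolding F_def by (intro DERIV_cdivide DERIV_chain2)
    moreover have "b (u / (u + 1)) * (a * v powr (a - 1) / (u + 1)\<^sup>2) / a = g v"
    proof -
      \<comment> \<open>At \<open>t = u / (u + 1)\<close> the two powers in \<open>b\<close> combine
        to \<open>u powr (- c) * (u + 1)\<close>; the square in the derivative of the substitution
        leaves one factor \<open>u + 1\<close> in the denominator.\<close>
      have "1 - u / (u + 1) = 1 / (u + 1)" using u by (simp add: field_simps)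
      then have "b (u / (u + 1)) = u powr (- c) / (u + 1) powr (- c) * (1 / (u + 1) powr (c - 1))"
        using u by (simp add: b_def powr_divide)
      also have "\<dots> = u powr (- c) * (u + 1)"
        using u by (simp add: powr_diff powr_minus field_simps)
      finally have "b (u / (u + 1)) * (a * v powr (a - 1) / (u + 1)\<^sup>2) / a
          = (u powr (- c) * v powr (a - 1)) / (u + 1)"
        using u a by (simp add: power2_eq_square)
      also have "u powr (- c) * v powr (a - 1) = v powr (a * (1 - c) - 1)"
        using v by (simp add: u_def powr_powr diff_diff_eq right_diff_distrib add.commute flip: powr_add)
      finally show ?thesis by (simp add: g_def u_def)
    qed
    ultimately show ?thesis by simp
  qed
  have contg: "continuous_on {0<..} g"
    unfolding g_def by (intro continuous_intros) (auto simp: add_nonneg_eq_0_iff)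
  have unit: "v powr a / (v powr a + 1) \<in> {0..1}" for v
  proof -
    have "0 < v powr a + 1" by (intro add_nonneg_pos) auto
    then show ?thesis by (simp add: divide_le_eq)
  qed
  have lim0: "(F \<longlongrightarrow> 0) (at_right 0)"
  proof -
    have "((\<lambda>v. v powr a / (v powr a + 1)) \<longlongrightarrow> 0) (at_right 0)"
      using a by real_asymp
    moreover have "eventually (\<lambda>v. v powr a / (v powr a + 1) \<in> {0..1}) (at_right 0)"
      using unit by (intro always_eventually allI)
    ultimately have "((\<lambda>v. B (v powr a / (v powr a + 1))) \<longlongrightarrow> B 0) (at_right 0)"
      by (intro continuous_on_tendsto_compose[OF contB]) auto
    from tendsto_divide[OF this tendsto_const, of a] show ?thesis
      using a by (simp add: F_def B_def)
  qed
  have limoo: "(F \<longlongrightarrow> pi / (a * sin (pi * c))) at_top"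
  proof -
    have "((\<lambda>v. v powr a / (v powr a + 1)) \<longlongrightarrow> 1) at_top"
      using a by real_asymp
    moreover have "eventually (\<lambda>v. v powr a / (v powr a + 1) \<in> {0..1}) at_top"
      using unit by (intro always_eventually allI)
    ultimately have "((\<lambda>v. B (v powr a / (v powr a + 1))) \<longlongrightarrow> B 1) at_top"
      by (intro continuous_on_tendsto_compose[OF contB]) auto
    from tendsto_divide[OF this tendsto_const, of a] show ?thesis
      using a b beta by (simp add: F_def B_def integral_unique mult.commute)
  qed
  have nn: "0 \<le> g v" if "0 < v" for v
    unfolding g_def by (intro divide_nonneg_nonneg add_nonneg_nonneg) auto
  show "set_integrable lborel {0<..} g" 
    by (rule FTC_Ioi_nonneg[OF derivF contg nn lim0 limoo])
  show "(g has_integral pi / (a * sin (pi * c))) {0<..}"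
    using FTC_Ioi_nonneg(2)[OF derivF contg nn lim0 limoo] by simp
qed

section \<open>Rotating the ray of integration\<close>

text \<open>The quotient \<open>(u + z) / (u + 1)\<close> is the convex combination of 1 and
  \<open>z\<close> with weights \<open>u / (u + 1)\<close> and \<open>1 / (u + 1)\<close>. The
  segment from 1 to \<open>z\<close> is compact and meets 0 only if \<open>z\<close> is a
  nonpositive real, so \<open>m\<close> is obtained from its distance to 0.\<close>

lemma norm_add_ge:
  fixes z :: complex
  assumes "z \<notin> \<real>\<^sub>\<le>\<^sub>0"
  obtains m where "0 < m" "\<And>u. 0 \<le> u \<Longrightarrow> m * (u + 1) \<le> norm (of_real u + z)"
proof -
  have "0 \<notin> closed_segment 1 z"
  proof
    assume "0 \<in> closed_segment 1 z"
    then obtain t where t: "0 \<le> t" "t \<le> 1" "0 = (1 - t) *\<^sub>R 1 + t *\<^sub>R z"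
      by (auto simp: closed_segment_def)
    then have "t \<noteq> 0" by auto
    with t have "z = of_real (- ((1 - t) / t))"
      by (auto simp: scaleR_conv_of_real field_simps add_eq_0_iff)
    moreover have "- ((1 - t) / t) \<le> 0" using t by auto
    ultimately show False using assms by (metis nonpos_Reals_of_real_iff)
  qed
  then obtain m where m: "0 < m" "\<And>w. w \<in> closed_segment 1 z \<Longrightarrow> m \<le> dist 0 w"
    using separate_point_closed[OF closed_segment, of 0 1 z] by auto
  have "m * (u + 1) \<le> norm (of_real u + z)" if u: "0 \<le> u" for u
  proof -
    have "(of_real u + z) / of_real (u + 1) = (1 - 1 / (u + 1)) *\<^sub>R 1 + (1 / (u + 1)) *\<^sub>R z"
    proof -
      have "1 - 1 / (u + 1) = u / (u + 1)" using u by (simp add: field_simps)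
      then show ?thesis by (simp add: scaleR_conv_of_real add_divide_distrib)
    qed
    then have "(of_real u + z) / of_real (u + 1) \<in> closed_segment 1 z"
      using u unfolding closed_segment_def by (intro CollectI exI[of _ "1 / (u + 1)"]) auto
    from m(2)[OF this] have "m \<le> norm (of_real u + z) / (u + 1)"
      using u by (simp add: dist_norm norm_divide del: of_real_add)
    then show ?thesis using u by (simp add: field_simps)
  qed
  with m(1) show ?thesis by (rule that)
qed

text \<open>The strip is convex and free of zeros of \<open>1 + exp z\<close>, so Cauchy's theorem
  provides a primitive \<open>P\<close>. A difference \<open>P (x - L) - P x\<close> is the integral
  of \<open>k\<close> along a segment of fixed length moving to either end, where \<open>k\<close>
  decays like \<open>exp (- c * Re z)\<close> on the right and \<open>exp ((1 - c) * Re z)\<close>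
  on the left.\<close>

lemma strip_kernel_primitive:
  fixes c :: real
  assumes "0 < c" "c < 1"
  defines "k \<equiv> \<lambda>z::complex. exp ((1 - of_real c) * z) / (1 + exp z)"
  shows "\<exists>P. (\<forall>z. \<bar>Im z\<bar> < pi \<longrightarrow> (P has_field_derivative k z) (at z)) \<and>
    (\<forall>L. \<bar>Im L\<bar> < pi \<longrightarrow> ((\<lambda>x. P (of_real x - L) - P (of_real x)) \<longlongrightarrow> 0) at_top) \<and>
    (\<forall>L. \<bar>Im L\<bar> < pi \<longrightarrow> ((\<lambda>x. P (of_real x - L) - P (of_real x)) \<longlongrightarrow> 0) at_bot)"
proof -
  define S where "S = {z. - pi < Im z} \<inter> {z. Im z < pi}"
  have S: "convex S" "open S"
    unfolding S_def by (auto intro!: convex_Int convex_halfspace_Im_gt convex_halfspace_Im_lt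
        open_Int open_halfspace_Im_gt open_halfspace_Im_lt)
  have S_iff: "z \<in> S \<longleftrightarrow> \<bar>Im z\<bar> < pi" for z by (auto simp: S_def)
  \<comment> \<open>Inside the strip \<open>Ln\<close> inverts \<open>exp\<close>, so a zero would
    have to be \<open>\<i> * pi\<close>, which lies on the boundary.\<close>
  have nz: "1 + exp z \<noteq> 0" if "z \<in> S" for z
  proof
    assume "1 + exp z = 0"
    then have "exp z = - 1" by (simp add: add_eq_0_iff)
    moreover have "Ln (exp z) = z" using that by (intro Ln_exp) (auto simp: S_def)
    ultimately have "z = \<i> * pi" by simp
    then show False using that by (simp add: S_def)
  qed
  have "k holomorphic_on S"
    unfolding k_def using nz by (intro holomorphic_intros) auto
  then obtain P where P: "\<And>z. z \<in> S \<Longrightarrow> (P has_field_derivative k z) (at z within S)"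
    using holomorphic_convex_primitive'[OF S] by metis
  have norm_k: "norm (k w) = exp ((1 - c) * Re w) / norm (1 + exp w)" for w
    by (simp add: k_def norm_divide)
  \<comment> \<open>Mean value estimate: the segment stays in the strip and within distance
    \<open>norm L\<close> of \<open>x\<close>, so a bound on \<open>k\<close> over the slab of that
    half-width suffices.\<close>
  have diff: "norm (P (of_real x - L) - P (of_real x)) \<le> B * norm L"
    if L: "\<bar>Im L\<bar> < pi" and B: "\<And>w. \<bar>Re w - x\<bar> \<le> norm L \<Longrightarrow> norm (k w) \<le> B" for x L B
  proof -
    let ?I = "closed_segment (of_real x - L) (of_real x)"
    have sub: "?I \<subseteq> S"
      using L by (intro closed_segment_subset S) (auto simp: S_iff)
    have sub': "?I \<subseteq> cball (of_real x) (norm L)"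
      by (intro closed_segment_subset convex_cball) (auto simp: dist_norm)
    have "norm (k w) \<le> B" if "w \<in> ?I" for w
    proof (rule B)
      have "\<bar>Re w - x\<bar> \<le> norm (w - of_real x)"
        using abs_Re_le_cmod[of "w - of_real x"] by simp
      also have "\<dots> \<le> norm L" using sub' that by (auto simp: dist_norm norm_minus_commute)
      finally show "\<bar>Re w - x\<bar> \<le> norm L" .
    qed
    then have "norm (P (of_real x - L) - P (of_real x)) \<le> B * norm (of_real x - L - of_real x)"
      using sub by (intro field_differentiable_bound[of ?I P k] convex_closed_segment
          has_field_derivative_subset[OF P]) auto
    then show ?thesis by simp
  qed
  show ?thesis
  proof (intro exI[of _ P] conjI allI impI)
    fix z assume "\<bar>Im z\<bar> < pi"
    then show "(P has_field_derivative k z) (at z)"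
      using P[of z] S_iff[of z] at_within_open[OF _ S(2), of z] by metis
  next
    fix L :: complex assume L: "\<bar>Im L\<bar> < pi"
    \<comment> \<open>The threshold \<open>norm L + 1\<close> ensures \<open>Re w \<ge> 1\<close> on
      the slab, hence \<open>exp (Re w) \<ge> 2\<close>, and then \<open>1 + exp w\<close> has norm
      at least half of \<open>exp (Re w)\<close>.\<close>
    have "norm (P (of_real x - L) - P (of_real x)) \<le> 2 * exp (- c * (x - norm L)) * norm L"
      if x: "norm L + 1 \<le> x" for x
    proof (rule diff[OF L])
      fix w assume "\<bar>Re w - x\<bar> \<le> norm L"
      then have w: "x - norm L \<le> Re w" by linarith
      have "2 \<le> exp (Re w)" using exp_ge_add_one_self[of "Re w"] w x by linarith
      then have "exp (Re w) / 2 \<le> norm (1 + exp w)"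
        using norm_triangle_ineq2[of "exp w" "- 1"] by (simp add: add.commute)
      then have "norm (k w) \<le> exp ((1 - c) * Re w) / (exp (Re w) / 2)"
        unfolding norm_k by (intro frac_le) auto
      also have "exp ((1 - c) * Re w) = exp (- c * Re w) * exp (Re w)"
        unfolding exp_add[symmetric] by (simp add: left_diff_distrib)
      also have "exp (- c * Re w) * exp (Re w) / (exp (Re w) / 2) = 2 * exp (- c * Re w)"
        by simp
      also have "\<dots> \<le> 2 * exp (- c * (x - norm L))"
        using w assms(1) by simp
      finally show "norm (k w) \<le> 2 * exp (- c * (x - norm L))" .
    qed
    then have "eventually (\<lambda>x. norm (P (of_real x - L) - P (of_real x)) \<le> 2 * exp (- c * (x - norm L)) * norm L) at_top"
      using eventually_ge_at_top by (rule eventually_mono[rotated])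
    moreover have "((\<lambda>x. 2 * exp (- c * (x - norm L)) * norm L) \<longlongrightarrow> 0) at_top"
      using assms(1) by real_asymp
    ultimately show "((\<lambda>x. P (of_real x - L) - P (of_real x)) \<longlongrightarrow> 0) at_top"
      by (rule Lim_null_comparison)
  next
    fix L :: complex assume L: "\<bar>Im L\<bar> < pi"
    \<comment> \<open>On the left \<open>Re w \<le> - 1\<close>, so
      \<open>exp (Re w) \<le> 1 / 2\<close> and the denominator has norm at least
      \<open>1 / 2\<close>.\<close>
    have "norm (P (of_real x - L) - P (of_real x)) \<le> 2 * exp ((1 - c) * (x + norm L)) * norm L"
      if x: "x \<le> - norm L - 1" for x
    proof (rule diff[OF L])
      fix w assume "\<bar>Re w - x\<bar> \<le> norm L"
      then have w: "Re w \<le> x + norm L" by linarith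
      have "2 \<le> exp (- Re w)" using exp_ge_add_one_self[of "- Re w"] w x by linarith
      then have "exp (Re w) \<le> 1 / 2" by (simp add: exp_minus field_simps)
      then have "1 / 2 \<le> norm (1 + exp w)"
        using norm_triangle_ineq2[of 1 "- exp w"] by simp
      then have "norm (k w) \<le> exp ((1 - c) * Re w) / (1 / 2)"
        unfolding norm_k by (intro frac_le) auto
      also have "\<dots> \<le> 2 * exp ((1 - c) * (x + norm L))"
        using w assms(2) by simp
      finally show "norm (k w) \<le> 2 * exp ((1 - c) * (x + norm L))" .
    qed
    then have "eventually (\<lambda>x. norm (P (of_real x - L) - P (of_real x)) \<le> 2 * exp ((1 - c) * (x + norm L)) * norm L) at_bot"
      using eventually_le_at_bot by (rule eventually_mono[rotated])
    moreover have "((\<lambda>x. 2 * exp ((1 - c) * (x + norm L)) * norm L) \<longlongrightarrow> 0) at_bot"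
      using assms(2) by real_asymp
    ultimately show "((\<lambda>x. P (of_real x - L) - P (of_real x)) \<longlongrightarrow> 0) at_bot"
      by (rule Lim_null_comparison)
  qed
qed

text \<open>In the variable \<open>x = a * ln v\<close>, the kernels for \<open>z\<close> and for 1
  become the same function \<open>k\<close>, evaluated at \<open>x - Ln z\<close> and at
  \<open>x\<close>. The difference of the two integrals therefore has a primitive vanishing at both
  ends, and the value for \<open>z\<close> is \<open>z powr (- c)\<close> times the value for
  1.\<close>

lemma has_integral_beta_kernel_complex:
  fixes a c :: real and z :: complex
  assumes a: "0 < a" and c: "0 < c" "c < 1" and z: "z \<notin> \<real>\<^sub>\<le>\<^sub>0"
  shows "((\<lambda>v. of_real (v powr (a * (1 - c) - 1)) / (of_real (v powr a) + z)) has_integral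
            of_real (pi / (a * sin (pi * c))) * z powr (- of_real c)) {0<..}"
proof -
  define g where "g = (\<lambda>v. v powr (a * (1 - c) - 1) / (v powr a + 1))"
  define G where "G = (\<lambda>w v. complex_of_real (v powr (a * (1 - c) - 1)) / (of_real (v powr a) + w))"
  note g = has_integral_beta_kernel_real[OF a c, folded g_def]
  have g_nonneg: "0 \<le> g v" for v unfolding g_def by simp
  have z0: "z \<noteq> 0" using z by auto
  define k where "k = (\<lambda>z::complex. exp ((1 - of_real c) * z) / (1 + exp z))"
  obtain P where P: "\<And>z. \<bar>Im z\<bar> < pi \<Longrightarrow> (P has_field_derivative k z) (at z)"
    and lim_top: "\<And>L. \<bar>Im L\<bar> < pi \<Longrightarrow> ((\<lambda>x. P (of_real x - L) - P (of_real x)) \<longlongrightarrow> 0) at_top"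
    and lim_bot: "\<And>L. \<bar>Im L\<bar> < pi \<Longrightarrow> ((\<lambda>x. P (of_real x - L) - P (of_real x)) \<longlongrightarrow> 0) at_bot"
    using strip_kernel_primitive[OF c] unfolding k_def by (elim exE conjE) blast
  define L where "L = Ln z"
  \<comment> \<open>The imaginary part of \<open>Ln z\<close> equals \<open>pi\<close> only on the
    negative axis, which is excluded.\<close>
  have L: "\<bar>Im L\<bar> < pi"
    using z z0 Im_Ln_le_pi[OF z0] mpi_less_Im_Ln[OF z0] Im_Ln_eq_pi[OF z0]
    unfolding L_def complex_nonpos_Reals_iff by (smt (verit))
  \<comment> \<open>The factor \<open>a / v\<close> is the derivative of \<open>a * ln v\<close>.
    The identity is applied with \<open>w = z\<close> and with \<open>w = 1\<close>, where
    \<open>Ln 1 = 0\<close>.\<close>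
  have k_eq: "of_real (a / v) * k (of_real (a * ln v) - Ln w) = of_real a * (w powr of_real c * G w v)"
    if v: "0 < v" and w: "w \<noteq> 0" for v w
  proof -
    have powr: "exp (complex_of_real (x * ln v)) = of_real (v powr x)" for x
      using v by (simp only: exp_of_real powr_def if_False less_imp_neq[THEN not_sym])
    have "(1 - of_real c) * (of_real (a * ln v) - Ln w)
        = of_real (a * (1 - c) * ln v) + (of_real c * Ln w - Ln w)"
      by (simp add: algebra_simps)
    then have 1: "exp ((1 - of_real c) * (of_real (a * ln v) - Ln w))
        = of_real (v powr (a * (1 - c))) * (w powr of_real c / w)"
      using w by (simp only: exp_add exp_diff powr) (simp add: powr_def)
    have 2: "1 + exp (of_real (a * ln v) - Ln w) = (of_real (v powr a) + w) / w"
      using w unfolding exp_diff powr by (simp add: add_divide_distrib)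
    have "complex_of_real (v powr (a * (1 - c) - 1)) = of_real (v powr (a * (1 - c))) / of_real v"
      using v by (simp add: powr_diff)
    then show ?thesis
      unfolding k_def 1 2 G_def using v w by (simp add: divide_simps)
  qed
  \<comment> \<open>\<open>H\<close> compares the integral along the ray through \<open>1 / z\<close> with the one along the positive axis.\<close>
  define H where "H = (\<lambda>v. P (of_real (a * ln v) - L) - P (of_real (a * ln v)))"
  define h where "h = (\<lambda>v. of_real a * (z powr of_real c * G z v - G 1 v))"
  have deriv: "(H has_vector_derivative h v) (at v)" if v: "0 < v" for v
  proof -
    have D: "((\<lambda>v. P (of_real (a * ln v) - w)) has_vector_derivative
        of_real (a / v) * k (of_real (a * ln v) - w)) (at v)" if w: "\<bar>Im w\<bar> < pi" for w
    proof -
      have "((\<lambda>v. complex_of_real (a * ln v)) has_vector_derivative of_real (a / v)) (at v)"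
        using v by (intro has_vector_derivative_of_real) (auto intro!: derivative_eq_intros)
      then have "((\<lambda>v. complex_of_real (a * ln v) - w) has_vector_derivative of_real (a / v)) (at v)"
        by (rule has_vector_derivative_diff_const[THEN iffD2])
      from field_vector_diff_chain_at[OF this P] show ?thesis
        using w by (simp add: o_def)
    qed
    have "(H has_vector_derivative of_real (a / v) * k (of_real (a * ln v) - L)
        - of_real (a / v) * k (of_real (a * ln v) - 0)) (at v)"
      unfolding H_def using D[OF L] D[of 0] by (intro has_vector_derivative_diff) auto
    also have "of_real (a / v) * k (of_real (a * ln v) - L)
        - of_real (a / v) * k (of_real (a * ln v) - 0) = h v"
      using k_eq[OF v z0] k_eq[OF v, of 1] by (simp add: h_def L_def right_diff_distrib)
    finally show ?thesis .
  qed
  have nz: "of_real (v powr a) + w \<noteq> 0" if "w \<notin> \<real>\<^sub>\<le>\<^sub>0" for w v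
  proof
    assume "of_real (v powr a) + w = 0"
    then have "w = of_real (- (v powr a))" by (simp add: add_eq_0_iff)
    moreover have "complex_of_real (- (v powr a)) \<in> \<real>\<^sub>\<le>\<^sub>0"
      by (subst nonpos_Reals_of_real_iff) simp
    ultimately show False using that by simp
  qed
  have cont: "continuous_on {0<..} h"
    unfolding h_def G_def using nz[OF z] nz[of 1] by (intro continuous_intros) auto
  obtain m where m: "0 < m" "\<And>u. 0 \<le> u \<Longrightarrow> m * (u + 1) \<le> norm (of_real u + z)"
    using norm_add_ge[OF z] by blast
  \<comment> \<open>The summand with \<open>m\<close> bounds the part of \<open>h\<close> coming
    from \<open>G z\<close>, the summand 1 the part from \<open>G 1\<close>, whose norm is exactly
    \<open>g\<close>.\<close>
  define C where "C = a * (norm (z powr of_real c) / m + 1)"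
  have dom: "norm (h v) \<le> C * g v" if "0 < v" for v
  proof -
    have "norm (G z v) \<le> v powr (a * (1 - c) - 1) / (m * (v powr a + 1))"
      unfolding G_def norm_divide using m that
      by (intro frac_le) (auto intro!: mult_pos_pos add_nonneg_pos)
    also have "\<dots> = g v / m" by (simp add: g_def)
    finally have 1: "norm (G z v) \<le> g v / m" .
    have "G 1 v = of_real (g v)" by (simp add: G_def g_def)
    then have 2: "norm (G 1 v) = g v" using g_nonneg[of v] by simp
    have "norm (z powr of_real c * G z v - G 1 v) \<le> norm (z powr of_real c) * (g v / m) + g v"
      using norm_triangle_ineq4[of "z powr of_real c * G z v" "G 1 v"] 2
        mult_left_mono[OF 1 norm_ge_zero, of "z powr of_real c"]
      by (simp add: norm_mult)
    then have "a * norm (z powr of_real c * G z v - G 1 v)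
        \<le> a * (norm (z powr of_real c) * (g v / m) + g v)"
      using a by (intro mult_left_mono) auto
    moreover have "norm (h v) = a * norm (z powr of_real c * G z v - G 1 v)"
      unfolding h_def norm_mult using a by simp
    ultimately show ?thesis
      by (simp add: C_def algebra_simps)
  qed
  have lim0: "(H \<longlongrightarrow> 0) (at_right 0)"
    unfolding H_def using a
    by (intro filterlim_compose[OF lim_bot[OF L]]) real_asymp
  have limoo: "(H \<longlongrightarrow> 0) at_top"
    unfolding H_def using a
    by (intro filterlim_compose[OF lim_top[OF L]]) real_asymp
  have "set_integrable lborel {0<..} (\<lambda>v. C * g v)" using g(1) by simp
  then have int_h: "(h has_integral 0) {0<..}"
    using FTC_Ioi_dominated[OF deriv cont _ dom lim0 limoo] by simp
  have "(G 1 has_integral of_real (pi / (a * sin (pi * c)))) {0<..}"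
    using has_integral_linear[OF g(2), of complex_of_real] bounded_linear_of_real
    by (simp add: o_def G_def g_def)
  \<comment> \<open>The definition of \<open>h\<close> is solved for \<open>G z\<close>; the
    integral of \<open>h\<close> being 0, only the value for \<open>G 1\<close> remains.\<close>
  from has_integral_mult_right[OF has_integral_add[OF has_integral_divide[OF int_h] this], of "1 / z powr of_real c" "of_real a"]
  have "((\<lambda>v. 1 / z powr of_real c * (h v / of_real a + G 1 v)) has_integral
      1 / z powr of_real c * of_real (pi / (a * sin (pi * c)))) {0<..}"
    by simp
  moreover have "1 / z powr of_real c * (h v / of_real a + G 1 v) = G z v" for v
    using a z0 by (simp add: h_def)
  ultimately show ?thesis
    using z0 by (simp add: G_def powr_minus divide_inverse mult.commute)
qed

section \<open>The logarithmic kernel\<close>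

lemma add_notin_nonpos_Reals:
  fixes z :: complex
  assumes "z \<notin> \<real>\<^sub>\<le>\<^sub>0" "0 \<le> u"
  shows "of_real u + z \<notin> \<real>\<^sub>\<le>\<^sub>0"
  using assms by (auto simp: complex_nonpos_Reals_iff)

text \<open>Taking out the positive real factor \<open>u\<close> causes no branch jump, so both
  logarithms contain the same term \<open>ln u\<close>, which cancels; the remainders
  \<open>Ln (1 + y / u)\<close> tend to \<open>Ln 1 = 0\<close>.\<close>

lemma tendsto_Ln_diff_at_top:
  fixes z w :: complex
  assumes "z \<notin> \<real>\<^sub>\<le>\<^sub>0" "w \<notin> \<real>\<^sub>\<le>\<^sub>0"
  shows "((\<lambda>u. Ln (of_real u + z) - Ln (of_real u + w)) \<longlongrightarrow> 0) at_top"
proof -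
  have lim: "((\<lambda>u. Ln (1 + y / of_real u)) \<longlongrightarrow> 0) at_top" for y :: complex
  proof -
    have "((\<lambda>u. 1 + y / of_real u) \<longlongrightarrow> 1 + 0) at_top"
      by (intro tendsto_add tendsto_const tendsto_divide_0[OF tendsto_const] filterlim_of_real_at_infinity
          filterlim_ident)
    from tendsto_Ln[OF this] show ?thesis by simp
  qed
  have split: "Ln (of_real u + y) = of_real (ln u) + Ln (1 + y / of_real u)"
    if "0 < u" "y \<notin> \<real>\<^sub>\<le>\<^sub>0" for u y
  proof -
    have eq: "of_real u + y = of_real u * (1 + y / of_real u)"
      using that by (simp add: distrib_left)
    moreover have "of_real u + y \<noteq> 0"
      using add_notin_nonpos_Reals[OF that(2), of u] that(1) by auto
    ultimately have "1 + y / of_real u \<noteq> 0" by auto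
    then show ?thesis unfolding eq using that by (simp add: Ln_times_of_real Ln_of_real)
  qed
  have "((\<lambda>u. Ln (1 + z / of_real u) - Ln (1 + w / of_real u)) \<longlongrightarrow> 0 - 0) at_top"
    by (intro tendsto_diff lim)
  moreover have "eventually (\<lambda>u. Ln (1 + z / of_real u) - Ln (1 + w / of_real u)
      = Ln (of_real u + z) - Ln (of_real u + w)) at_top"
    using eventually_gt_at_top[of 0] by eventually_elim (simp add: split assms)
  ultimately show ?thesis
    by (simp add: tendsto_cong)
qed

text \<open>By partial fractions \<open>F\<close> below is a primitive. The paths
  \<open>v powr a + z\<close> and \<open>v powr a + w\<close> avoid the branch cut, so
  \<open>F\<close> is differentiable throughout; it vanishes at infinity and the value at 0 gives
  the result.\<close>

lemma has_integral_Ln_kernel: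
  fixes a :: real and z w :: complex
  assumes a: "0 < a" and z: "z \<notin> \<real>\<^sub>\<le>\<^sub>0" and w: "w \<notin> \<real>\<^sub>\<le>\<^sub>0" and zw: "z \<noteq> w"
  shows "((\<lambda>v. of_real (v powr (a - 1)) / ((of_real (v powr a) + z) * (of_real (v powr a) + w)))
            has_integral (Ln w - Ln z) / (of_real a * (w - z))) {0<..}"
proof -
  define f where "f = (\<lambda>v. complex_of_real (v powr (a - 1)) /
      ((of_real (v powr a) + z) * (of_real (v powr a) + w)))"
  \<comment> \<open>The majorant, up to a constant: its elementary primitive is
    \<open>- 1 / (a * (v powr a + 1))\<close>.\<close>
  define g where "g = (\<lambda>v. v powr (a - 1) / (v powr a + 1)\<^sup>2)"
  have pos: "0 < v powr a + 1" for v by (intro add_nonneg_pos) auto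
  have g: "set_integrable lborel {0<..} g"
  proof (rule FTC_Ioi_nonneg)
    fix v :: real assume v: "0 < v"
    show "((\<lambda>v. - (1 / (v powr a + 1)) / a) has_real_derivative g v) (at v)"
      unfolding g_def using a v less_imp_neq[OF pos[of v]]
      by (auto intro!: derivative_eq_intros simp: power2_eq_square)
    show "0 \<le> g v" by (simp add: g_def)
  next
    show "continuous_on {0<..} g"
      unfolding g_def using less_imp_neq[OF pos] by (intro continuous_intros) force+
    show "((\<lambda>v. - (1 / (v powr a + 1)) / a) \<longlongrightarrow> - inverse a) (at_right 0)"
      using a by real_asymp
    show "((\<lambda>v. - (1 / (v powr a + 1)) / a) \<longlongrightarrow> 0) at_top"
      using a by real_asymp
  qed
  have nz: "of_real (v powr a) + y \<noteq> 0" if "y \<notin> \<real>\<^sub>\<le>\<^sub>0" for y :: complex and v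
    using add_notin_nonpos_Reals[OF that, of "v powr a"] by auto
  obtain m where m: "0 < m" "\<And>u. 0 \<le> u \<Longrightarrow> m * (u + 1) \<le> norm (of_real u + z)"
    using norm_add_ge[OF z] by blast
  obtain n where n: "0 < n" "\<And>u. 0 \<le> u \<Longrightarrow> n * (u + 1) \<le> norm (of_real u + w)"
    using norm_add_ge[OF w] by blast
  define F where "F = (\<lambda>v. (Ln (of_real (v powr a) + z) - Ln (of_real (v powr a) + w)) / (of_real a * (w - z)))"
  have "(f has_integral 0 - (Ln z - Ln w) / (of_real a * (w - z))) {0<..}"
  proof (rule FTC_Ioi_dominated)
    show "set_integrable lborel {0<..} (\<lambda>v. 1 / (m * n) * g v)" using g by simp
    show "continuous_on {0<..} f"
      unfolding f_def using nz[OF z] nz[OF w] by (intro continuous_intros) auto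
  next
    fix v :: real assume v: "0 < v"
    have "norm (f v) \<le> v powr (a - 1) / ((m * (v powr a + 1)) * (n * (v powr a + 1)))"
      unfolding f_def norm_divide norm_mult using m n v pos[of v]
      by (intro frac_le mult_mono) auto
    also have "\<dots> = 1 / (m * n) * g v" by (simp add: g_def power2_eq_square)
    finally show "norm (f v) \<le> 1 / (m * n) * g v" .
    define u where "u = complex_of_real (v powr a)"
    have D: "((\<lambda>v. Ln (of_real (v powr a) + y)) has_vector_derivative
        of_real (a * v powr (a - 1)) * (1 / (u + y))) (at v)" if "y \<notin> \<real>\<^sub>\<le>\<^sub>0" for y
    proof -
      have "((\<lambda>v. complex_of_real (v powr a)) has_vector_derivative of_real (a * v powr (a - 1))) (at v)"
        using v by (intro has_vector_derivative_of_real) (auto intro!: derivative_eq_intros)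
      then have "((\<lambda>v. of_real (v powr a) + y) has_vector_derivative of_real (a * v powr (a - 1))) (at v)"
        by (rule has_vector_derivative_add_const[THEN iffD2])
      moreover have "(Ln has_field_derivative 1 / (u + y)) (at (of_real (v powr a) + y))"
        unfolding u_def using add_notin_nonpos_Reals[OF that, of "v powr a"]
        by (auto intro!: derivative_eq_intros simp: field_simps)
      ultimately show ?thesis
        using field_vector_diff_chain_at by (fastforce simp: o_def)
    qed
    have "(F has_vector_derivative (of_real (a * v powr (a - 1)) * (1 / (u + z))
        - of_real (a * v powr (a - 1)) * (1 / (u + w))) / (of_real a * (w - z))) (at v)"
      unfolding F_def by (intro has_vector_derivative_divide has_vector_derivative_diff D z w)
    also have "(of_real (a * v powr (a - 1)) * (1 / (u + z))
        - of_real (a * v powr (a - 1)) * (1 / (u + w))) / (of_real a * (w - z)) = f v"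
    proof -
      have "1 / (u + z) - 1 / (u + w) = (w - z) / ((u + z) * (u + w))"
        using nz[OF z, of v] nz[OF w, of v] by (simp add: u_def diff_frac_eq)
      then show ?thesis
        unfolding right_diff_distrib[symmetric] using a zw by (simp add: f_def u_def)
    qed
    finally show "(F has_vector_derivative f v) (at v)" .
  next
    have u0: "((\<lambda>v. complex_of_real (v powr a)) \<longlongrightarrow> of_real 0) (at_right 0)"
      using a by (intro tendsto_of_real) real_asymp
    have lim: "((\<lambda>v. Ln (of_real (v powr a) + y)) \<longlongrightarrow> Ln y) (at_right 0)" if "y \<notin> \<real>\<^sub>\<le>\<^sub>0" for y
      using tendsto_Ln[OF tendsto_add[OF u0 tendsto_const], of y] that by simp
    show "(F \<longlongrightarrow> (Ln z - Ln w) / (of_real a * (w - z))) (at_right 0)"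
      unfolding F_def using a zw by (intro tendsto_divide tendsto_diff tendsto_const lim z w) auto
  next
    have "filterlim (\<lambda>v::real. v powr a) at_top at_top" using a by real_asymp
    from tendsto_divide[OF filterlim_compose[OF tendsto_Ln_diff_at_top[OF z w] this] tendsto_const,
        of "of_real a * (w - z)"]
    show "(F \<longlongrightarrow> 0) at_top" using a zw by (simp add: F_def)
  qed
  then show ?thesis by (simp add: f_def minus_divide_left)
qed

section \<open>A divergence criterion for improper integrals\<close>

text \<open>Convergence may be conditional, so the argument is Cauchy's criterion: integrals over
  large boxes differ by less than 2, whereas the lower bound \<open>k / v\<close> contributes
  \<open>k * ln (b / d)\<close> on \<open>{d..b}\<close>.\<close>

lemma not_integrable_Ioi:
  fixes f :: "real \<Rightarrow> real"
  assumes c: "0 < c" and k: "0 < k" and bound: "\<And>v. c \<le> v \<Longrightarrow> k / v \<le> f v"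
  shows "\<not> f integrable_on {0<..}"
proof
  assume "f integrable_on {0<..}"
  then obtain I where I: "(f has_integral I) {0<..}" by auto
  define g where "g = (\<lambda>x. if x \<in> {0<..} then f x else 0)"
  have gi: "g integrable_on cbox a b" for a b
    using I unfolding has_integral_alt' g_def by blast
  obtain B where B: "0 < B" "\<And>a b. ball 0 B \<subseteq> cbox a b \<Longrightarrow> norm (integral (cbox a b) g - I) < 1"
    using I unfolding has_integral_alt' g_def[symmetric] by (meson zero_less_one)
  define d where "d = max B c"
  \<comment> \<open>Chosen so that the integral of \<open>k / v\<close> over \<open>{d..b}\<close>
    is exactly 2.\<close>
  define b where "b = d * exp (2 / k)"
  have d: "0 < d" "c \<le> d" "B \<le> d" using c by (auto simp: d_def)
  have db: "d \<le> b" using d k by (simp add: b_def)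
  \<comment> \<open>The boxes start at \<open>- d\<close> in order to contain the ball around 0.
    Subtracting the cases \<open>x = d\<close> and \<open>x = b\<close> isolates the integral over
    \<open>{d..b}\<close>.\<close>
  have near: "norm (integral {- d..x} g - I) < 1" if "d \<le> x" for x
  proof -
    have "ball 0 B \<subseteq> cbox (- d) x" using that d by (auto simp: dist_real_def)
    from B(2)[OF this] show ?thesis by simp
  qed
  have "integral {- d..d} g + integral {d..b} g = integral {- d..b} g"
    using db d gi[of "- d" b] by (intro Henstock_Kurzweil_Integration.integral_combine) auto
  then have upper: "integral {d..b} g < 2"
    using near[of d] near[OF db] unfolding real_norm_def by linarith
  have "((\<lambda>v. k / v) has_integral (k * ln b - k * ln d)) {d..b}"
    using db d
    by (intro fundamental_theorem_of_calculus)
       (auto intro!: derivative_eq_intros simp flip: has_real_derivative_iff_has_vector_derivative)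
  moreover have "(g has_integral integral {d..b} g) {d..b}"
    using gi[of d b] by (simp add: integrable_integral)
  ultimately have "k * ln b - k * ln d \<le> integral {d..b} g"
    by (rule has_integral_le) (use d bound in \<open>auto simp: g_def\<close>)
  moreover have "k * ln b - k * ln d = 2"
    using d k by (simp add: b_def ln_mult algebra_simps)
  ultimately show False using upper by simp
qed

section \<open>Factorisation of the denominator\<close>

text \<open>The rotated argument stays strictly between \<open>- pi\<close> and \<open>pi\<close>,
  so the principal logarithm is additive here and the branch cut is not met.\<close>

lemma Ln_mult_cis:
  fixes x :: real
  assumes "lam \<noteq> 0" "\<bar>Arg lam + x\<bar> < pi"
  shows "Ln (lam * cis x) = Ln lam + \<i> * of_real x" and "lam * cis x \<notin> \<real>\<^sub>\<le>\<^sub>0"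
proof -
  have e: "exp (Ln lam + \<i> * of_real x) = lam * cis x"
    using assms by (simp add: exp_add cis_conv_exp)
  have im: "Im (Ln lam + \<i> * of_real x) = Arg lam + x"
    using assms by (simp add: Arg_eq_Im_Ln)
  show L: "Ln (lam * cis x) = Ln lam + \<i> * of_real x"
    unfolding e[symmetric] by (rule Ln_exp) (use assms im in auto)
  show "lam * cis x \<notin> \<real>\<^sub>\<le>\<^sub>0"
  proof
    assume "lam * cis x \<in> \<real>\<^sub>\<le>\<^sub>0"
    moreover have w: "lam * cis x \<noteq> 0" using assms by simp
    ultimately have "Re (lam * cis x) < 0 \<and> Im (lam * cis x) = 0"
      unfolding complex_nonpos_Reals_iff by (metis complex_eq_iff less_le zero_complex.sel)
    then have "Im (Ln (lam * cis x)) = pi" using Im_Ln_eq_pi[OF w] by simp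
    then show False using im assms(2) unfolding L by simp
  qed
qed

text \<open>As a quadratic in \<open>v powr \<alpha>\<close>, the denominator has the roots
  \<open>lam * cis (\<alpha> * pi)\<close> and \<open>lam * cis (- \<alpha> * pi)\<close>. Shifting
  the angle by \<open>pi\<close> absorbs their sign, so that both factors have the form
  \<open>u + z\<close> of the kernels above.\<close>

lemma denom_factor:
  fixes \<alpha> :: real
  defines "y \<equiv> pi * (\<alpha> - 1)"
  shows "denom \<alpha> lam v = (of_real (v powr \<alpha>) + lam * cis y) * (of_real (v powr \<alpha>) + lam * cis (- y))"
proof -
  have "cos y = - cos (\<alpha> * pi)"
    using cos_minus_pi[of "\<alpha> * pi"] by (simp add: y_def algebra_simps)
  then have sum: "cis y + cis (- y) = of_real (- 2 * cos (\<alpha> * pi))"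
    by (simp add: complex_eq_iff)
  have prod: "cis y * cis (- y) = 1" by (simp add: cis_mult)
  have sq: "complex_of_real (v powr (2 * \<alpha>)) = of_real (v powr \<alpha>) * of_real (v powr \<alpha>)"
    by (simp flip: powr_add of_real_mult)
  have "(of_real (v powr \<alpha>) + lam * cis y) * (of_real (v powr \<alpha>) + lam * cis (- y))
      = of_real (v powr \<alpha>) * of_real (v powr \<alpha>) + lam * of_real (v powr \<alpha>) * (cis y + cis (- y))
        + lam * lam * (cis y * cis (- y))"
    by (simp only: algebra_simps)
  then show ?thesis
    unfolding sum prod denom_def sq by (simp add: power2_eq_square)
qed

lemma f_fun_eq:
  "f_fun \<alpha> \<beta> lam v = of_real (sin (\<beta> * pi) / pi) * M1_integrand \<alpha> \<beta> lam v
    + lam * of_real (sin (pi * (\<alpha> - \<beta>)) / pi) * M2_integrand \<alpha> \<beta> lam v"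
proof -
  have pow: "complex_of_real (v powr (2 * \<alpha> - \<beta>)) = of_real (v powr (\<alpha> - \<beta>)) * of_real (v powr \<alpha>)"
    unfolding of_real_mult[symmetric] powr_add[symmetric] by (simp add: algebra_simps)
  have "1 / P * p * ((u * S + l * T) / D) = S / P * (p * u / D) + l * (T / P) * (p / D)"
    for P p u S l T D :: complex
    by (simp add: divide_inverse algebra_simps)
  then show ?thesis
    unfolding f_fun_def M1_integrand_def M2_integrand_def pow mult.commute[of pi "\<alpha> - \<beta>"]
    by (simp only: of_real_divide of_real_1)
qed

section \<open>Evaluation and divergence for a fixed order and parameter\<close>

context
  fixes \<alpha> :: real and lam :: complex
  assumes \<alpha>: "0 < \<alpha>" "\<alpha> < 1" and lam: "lam \<noteq> 0" and arg: "\<bar>Arg lam\<bar> < pi * \<alpha>"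
begin

private definition "y = pi * (\<alpha> - 1)"
private definition "z1 = lam * cis y"
private definition "z2 = lam * cis (- y)"

text \<open>Since \<open>\<bar>y\<bar> = pi - pi * \<alpha>\<close>, the bound on
  \<open>Arg lam\<close> is exactly what keeps \<open>Arg lam + y\<close> and
  \<open>Arg lam - y\<close> inside the principal range.\<close>

private lemma Ln_z: "Ln z1 = Ln lam + \<i> * of_real y" "Ln z2 = Ln lam - \<i> * of_real y"
  and z_notin: "z1 \<notin> \<real>\<^sub>\<le>\<^sub>0" "z2 \<notin> \<real>\<^sub>\<le>\<^sub>0"
proof -
  have "y = pi * \<alpha> - pi" by (simp add: y_def right_diff_distrib)
  moreover have "0 < pi * \<alpha>" "pi * \<alpha> < pi" using \<alpha> by auto
  ultimately have "\<bar>Arg lam + y\<bar> < pi" "\<bar>Arg lam + - y\<bar> < pi"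
    using arg by linarith+
  from Ln_mult_cis[OF lam this(1)] Ln_mult_cis[OF lam this(2)]
  show "Ln z1 = Ln lam + \<i> * of_real y" "Ln z2 = Ln lam - \<i> * of_real y"
    "z1 \<notin> \<real>\<^sub>\<le>\<^sub>0" "z2 \<notin> \<real>\<^sub>\<le>\<^sub>0"
    unfolding z1_def z2_def by simp_all
qed

private lemma nz: "of_real (v powr \<alpha>) + z1 \<noteq> 0" "of_real (v powr \<alpha>) + z2 \<noteq> 0"
  using add_notin_nonpos_Reals[OF z_notin(1), of "v powr \<alpha>"]
    add_notin_nonpos_Reals[OF z_notin(2), of "v powr \<alpha>"] by auto

private lemma denom_eq: "denom \<alpha> lam v = (of_real (v powr \<alpha>) + z1) * (of_real (v powr \<alpha>) + z2)"
  unfolding denom_factor z1_def z2_def y_def ..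

private lemma sin_y: "sin y = - sin (pi * \<alpha>)"
  using sin_minus_pi[of "pi * \<alpha>"] by (simp add: y_def right_diff_distrib)

private lemma sin_pos: "0 < sin (pi * \<alpha>)"
  using \<alpha> by (intro sin_gt_zero) auto

private lemma z_diff: "z2 - z1 = 2 * \<i> * lam * of_real (sin (pi * \<alpha>))" "z1 \<noteq> z2"
proof -
  have "cis (- y) - cis y = 2 * \<i> * of_real (sin (pi * \<alpha>))"
    using sin_y by (simp add: complex_eq_iff)
  then show "z2 - z1 = 2 * \<i> * lam * of_real (sin (pi * \<alpha>))"
    unfolding z1_def z2_def right_diff_distrib[symmetric] by (simp add: mult_ac)
  then show "z1 \<noteq> z2" using lam sin_pos by auto
qed

text \<open>Partial fractions express both integrands through the kernels \<open>K z1\<close> and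
  \<open>K z2\<close>. In the required combination, the coefficients of \<open>J z1\<close> and
  \<open>J z2\<close> collapse to pure phases times a common factor, and these phases combine with
  those of \<open>z1 powr (- c)\<close> and \<open>z2 powr (- c)\<close> to leave only
  \<open>sin (pi * c)\<close>.\<close>

lemma has_integral_M_integrands:
  fixes c :: real
  assumes c: "0 < c" "c < 1" and \<beta>: "\<beta> = 1 + \<alpha> * c"
  obtains I1 I2 where "(M1_integrand \<alpha> \<beta> lam has_integral I1) {0<..}"
    and "(M2_integrand \<alpha> \<beta> lam has_integral I2) {0<..}"
    and "of_real (sin (\<beta> * pi) / pi) * I1 + lam * of_real (sin (pi * (\<alpha> - \<beta>)) / pi) * I2
      = - (lam powr (- of_real c) / of_real \<alpha>)"
proof -
  define K where "K = (\<lambda>z v. complex_of_real (v powr (\<alpha> - \<beta>)) / (of_real (v powr \<alpha>) + z))"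
  define J where "J = (\<lambda>z. complex_of_real (pi / (\<alpha> * sin (pi * c))) * z powr (- of_real c))"
  have exponent: "\<alpha> * (1 - c) - 1 = \<alpha> - \<beta>" by (simp add: \<beta> algebra_simps)
  have K: "(K z1 has_integral J z1) {0<..}" "(K z2 has_integral J z2) {0<..}"
    unfolding K_def J_def
    using has_integral_beta_kernel_complex[OF \<alpha>(1) c z_notin(1)] has_integral_beta_kernel_complex[OF \<alpha>(1) c z_notin(2)]
    unfolding exponent by auto
  have partial: "1 / ((u + z1) * (u + z2)) = (1 / (u + z1) - 1 / (u + z2)) / (z2 - z1)"
    "u / ((u + z1) * (u + z2)) = (z2 / (u + z2) - z1 / (u + z1)) / (z2 - z1)"
    if "u + z1 \<noteq> 0" "u + z2 \<noteq> 0" for u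
  proof -
    have "z2 - z1 \<noteq> 0" using z_diff(2) by simp
    moreover have "1 / (u + z1) - 1 / (u + z2) = (z2 - z1) / ((u + z1) * (u + z2))"
      using that by (simp add: diff_frac_eq)
    moreover have "z2 / (u + z2) - z1 / (u + z1) = (z2 - z1) * u / ((u + z1) * (u + z2))"
      using that by (simp add: diff_frac_eq algebra_simps)
    ultimately show "1 / ((u + z1) * (u + z2)) = (1 / (u + z1) - 1 / (u + z2)) / (z2 - z1)"
      "u / ((u + z1) * (u + z2)) = (z2 / (u + z2) - z1 / (u + z1)) / (z2 - z1)"
      by simp_all
  qed
  have M2: "M2_integrand \<alpha> \<beta> lam v = (K z1 v - K z2 v) / (z2 - z1)" for v
  proof -
    have "M2_integrand \<alpha> \<beta> lam v = of_real (v powr (\<alpha> - \<beta>)) * (1 / ((of_real (v powr \<alpha>) + z1) * (of_real (v powr \<alpha>) + z2)))"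
      by (simp add: M2_integrand_def denom_eq)
    also have "\<dots> = (K z1 v - K z2 v) / (z2 - z1)"
      unfolding partial(1)[OF nz] by (simp add: K_def right_diff_distrib)
    finally show ?thesis .
  qed
  have M1: "M1_integrand \<alpha> \<beta> lam v = (z2 * K z2 v - z1 * K z1 v) / (z2 - z1)" for v
  proof -
    have "complex_of_real (v powr (2 * \<alpha> - \<beta>)) = of_real (v powr (\<alpha> - \<beta>)) * of_real (v powr \<alpha>)"
      unfolding of_real_mult[symmetric] powr_add[symmetric] by (simp add: algebra_simps)
    then have "M1_integrand \<alpha> \<beta> lam v = of_real (v powr (\<alpha> - \<beta>)) * (of_real (v powr \<alpha>) / ((of_real (v powr \<alpha>) + z1) * (of_real (v powr \<alpha>) + z2)))"
      by (simp add: M1_integrand_def denom_eq)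
    also have "\<dots> = (z2 * K z2 v - z1 * K z1 v) / (z2 - z1)"
      unfolding partial(2)[OF nz] by (simp add: K_def right_diff_distrib mult_ac)
    finally show ?thesis .
  qed
  define b where "b = pi * \<beta>"
  \<comment> \<open>Additivity of the logarithm in \<open>Ln_z\<close> makes the principal powers
    split without correction terms.\<close>
  have Jz: "J z1 = J lam * cis (- c * y)" "J z2 = J lam * cis (c * y)"
  proof -
    have "z1 \<noteq> 0" "z2 \<noteq> 0" using lam by (auto simp: z1_def z2_def)
    then show "J z1 = J lam * cis (- c * y)" "J z2 = J lam * cis (c * y)"
      using lam unfolding J_def powr_def Ln_z
      by (simp_all add: cis_conv_exp algebra_simps flip: exp_add)
  qed
  have cis_pi: "cis (x + pi) = - cis x" "cis (x - pi) = - cis x" for x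
    by (simp_all add: complex_eq_iff)
  have cy: "- c * y = pi * c - b + pi" "c * y = b - pi * c - pi"
    by (simp_all add: b_def \<beta> y_def algebra_simps)
  \<comment> \<open>The coefficient of \<open>J z1\<close>, by
    \<open>sin (p - b) + cis p * sin b = sin p * cis b\<close> with
    \<open>p = pi * \<alpha>\<close>; \<open>n2\<close> is the conjugate identity for
    \<open>J z2\<close>, up to sign.\<close>
  have n1: "lam * of_real (sin (pi * \<alpha> - b)) - z1 * of_real (sin b) = lam * of_real (sin (pi * \<alpha>)) * cis b"
  proof -
    have "y = pi * \<alpha> - pi" by (simp add: y_def right_diff_distrib)
    then have "cis y = - cis (pi * \<alpha>)" by (simp only: cis_pi)
    then have "lam * of_real (sin (pi * \<alpha> - b)) - z1 * of_real (sin b)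
        = lam * (of_real (sin (pi * \<alpha> - b)) + cis (pi * \<alpha>) * of_real (sin b))"
      unfolding z1_def by (simp add: distrib_left mult.assoc)
    also have "of_real (sin (pi * \<alpha> - b)) + cis (pi * \<alpha>) * of_real (sin b) = of_real (sin (pi * \<alpha>)) * cis b"
      by (simp add: complex_eq_iff sin_diff)
    finally show ?thesis by (simp only: mult.assoc)
  qed
  have n2: "z2 * of_real (sin b) - lam * of_real (sin (pi * \<alpha> - b)) = - (lam * of_real (sin (pi * \<alpha>)) * cis (- b))"
  proof -
    have "- y = - (pi * \<alpha>) + pi" by (simp add: y_def right_diff_distrib)
    then have "cis (- y) = - cis (- (pi * \<alpha>))" by (simp only: cis_pi)
    then have "z2 * of_real (sin b) - lam * of_real (sin (pi * \<alpha> - b))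
        = - (lam * (of_real (sin (pi * \<alpha> - b)) + cis (- (pi * \<alpha>)) * of_real (sin b)))"
      unfolding z2_def by (simp add: distrib_left mult.assoc)
    also have "of_real (sin (pi * \<alpha> - b)) + cis (- (pi * \<alpha>)) * of_real (sin b) = of_real (sin (pi * \<alpha>)) * cis (- b)"
      by (simp add: complex_eq_iff sin_diff)
    finally show ?thesis by (simp only: mult.assoc)
  qed
  define I1 where "I1 = (z2 * J z2 - z1 * J z1) / (z2 - z1)"
  define I2 where "I2 = (J z1 - J z2) / (z2 - z1)"
  show thesis
  proof (rule that)
    show "(M1_integrand \<alpha> \<beta> lam has_integral I1) {0<..}"
      unfolding M1 I1_def
      by (intro has_integral_divide has_integral_diff has_integral_mult_right K)
    show "(M2_integrand \<alpha> \<beta> lam has_integral I2) {0<..}"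
      unfolding M2 I2_def
      by (intro has_integral_divide has_integral_diff K)
    have sb: "sin (\<beta> * pi) = sin b" "sin (pi * (\<alpha> - \<beta>)) = sin (pi * \<alpha> - b)"
      by (simp_all add: b_def mult.commute right_diff_distrib)
    have "of_real (sin b / pi) * I1 + lam * of_real (sin (pi * \<alpha> - b) / pi) * I2
        = (of_real (sin b) * (z2 * J z2 - z1 * J z1) + lam * of_real (sin (pi * \<alpha> - b)) * (J z1 - J z2))
          / (of_real pi * (z2 - z1))"
      unfolding I1_def I2_def of_real_divide by (simp add: add_divide_distrib)
    also have "of_real (sin b) * (z2 * J z2 - z1 * J z1) + lam * of_real (sin (pi * \<alpha> - b)) * (J z1 - J z2)
        = J z1 * (lam * of_real (sin (pi * \<alpha> - b)) - z1 * of_real (sin b))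
          + J z2 * (z2 * of_real (sin b) - lam * of_real (sin (pi * \<alpha> - b)))"
      by (simp add: algebra_simps)
    also have "\<dots> = lam * of_real (sin (pi * \<alpha>)) * (J z1 * cis b - J z2 * cis (- b))"
      unfolding n1 n2 by (simp add: algebra_simps)
    \<comment> \<open>By \<open>cy\<close> the angle \<open>b\<close> cancels in both products, and
      the shift by \<open>pi\<close> reverses the signs.\<close>
    also have "J z1 * cis b - J z2 * cis (- b) = J lam * (cis (- (pi * c)) - cis (pi * c))"
      unfolding Jz cy cis_pi
      by (simp add: cis_mult mult.assoc right_diff_distrib flip: minus_mult_right)
    also have "cis (- (pi * c)) - cis (pi * c) = - 2 * \<i> * of_real (sin (pi * c))"
      by (simp add: complex_eq_iff)
    also have "lam * of_real (sin (pi * \<alpha>)) * (J lam * (- 2 * \<i> * of_real (sin (pi * c)))) / (of_real pi * (z2 - z1))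
        = - (J lam * of_real (sin (pi * c)) / of_real pi)"
      unfolding z_diff(1) using lam sin_pos by (simp add: field_simps)
    also have "\<dots> = - (lam powr (- of_real c) / of_real \<alpha>)"
    proof -
      have "0 < sin (pi * c)" using c by (intro sin_gt_zero) auto
      then show ?thesis unfolding J_def by (simp add: field_simps)
    qed
    finally show "of_real (sin (\<beta> * pi) / pi) * I1 + lam * of_real (sin (pi * (\<alpha> - \<beta>)) / pi) * I2
      = - (lam powr (- of_real c) / of_real \<alpha>)"
      unfolding sb .
  qed
qed

text \<open>The logarithms of \<open>z2\<close> and \<open>z1\<close> differ by
  \<open>- 2 * \<i> * y\<close>, whose factor \<open>2 * \<i>\<close> cancels against that of
  \<open>z2 - z1\<close>.\<close>

lemma has_integral_M2_integrand_1:
  "(M2_integrand \<alpha> 1 lam has_integral of_real (pi * (1 - \<alpha>)) / (of_real \<alpha> * lam * of_real (sin (pi * \<alpha>)))) {0<..}"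
proof -
  have "(Ln z2 - Ln z1) / (of_real \<alpha> * (z2 - z1)) = of_real (- y) / (of_real \<alpha> * lam * of_real (sin (pi * \<alpha>)))"
    unfolding Ln_z z_diff(1) by (simp add: field_simps)
  moreover have "- y = pi * (1 - \<alpha>)" by (simp add: y_def algebra_simps)
  moreover have "((\<lambda>v. of_real (v powr (\<alpha> - 1)) / denom \<alpha> lam v) has_integral
      (Ln z2 - Ln z1) / (of_real \<alpha> * (z2 - z1))) {0<..}"
    unfolding denom_eq by (rule has_integral_Ln_kernel[OF \<alpha>(1) z_notin z_diff(2)])
  ultimately show ?thesis
    unfolding M2_integrand_def by simp
qed

lemma f_fun_not_integrable: "\<not> f_fun \<alpha> \<alpha> lam integrable_on {0<..}"
proof
  assume int: "f_fun \<alpha> \<alpha> lam integrable_on {0<..}"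
  define s where "s = sin (pi * \<alpha>) / pi"
  have s: "0 < s" using sin_pos by (simp add: s_def)
  \<comment> \<open>At \<beta> = \<alpha> the term with
    \<open>sin ((\<alpha> - \<beta>) * pi)\<close> vanishes; the remaining quotient is normalised so
    that each factor of the denominator tends to 1.\<close>
  have f_eq: "of_real (v powr \<alpha>) * f_fun \<alpha> \<alpha> lam v
      = of_real s * (1 / ((1 + z1 / of_real (v powr \<alpha>)) * (1 + z2 / of_real (v powr \<alpha>))))"
    if v: "0 < v" for v
  proof -
    define u where "u = complex_of_real (v powr \<alpha>)"
    have u: "u \<noteq> 0" using v by (simp add: u_def)
    have "f_fun \<alpha> \<alpha> lam v = of_real s * (u / ((u + z1) * (u + z2)))"
      using v by (simp add: f_fun_def denom_eq u_def s_def mult.commute)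
    moreover have "(u + z1) * (u + z2) = u * u * ((1 + z1 / u) * (1 + z2 / u))"
      using u by (simp add: field_simps)
    ultimately show ?thesis
      using u by (simp flip: u_def)
  qed
  have lim1: "((\<lambda>v. 1 + z / of_real (v powr \<alpha>)) \<longlongrightarrow> 1 + 0) at_top" for z :: complex
  proof -
    have "filterlim (\<lambda>v::real. v powr \<alpha>) at_top at_top" using \<alpha> by real_asymp
    then show ?thesis
      by (intro tendsto_add tendsto_const tendsto_divide_0[OF tendsto_const]
          filterlim_compose[OF filterlim_of_real_at_infinity])
  qed
  have "((\<lambda>v. of_real s * (1 / ((1 + z1 / of_real (v powr \<alpha>)) * (1 + z2 / of_real (v powr \<alpha>)))))
      \<longlongrightarrow> of_real s * (1 / ((1 + 0) * (1 + 0)))) at_top"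
    by (intro tendsto_intros lim1) auto
  then have "((\<lambda>v. of_real s * (1 / ((1 + z1 / of_real (v powr \<alpha>)) * (1 + z2 / of_real (v powr \<alpha>)))))
      \<longlongrightarrow> of_real s) at_top" by simp
  moreover have "eventually (\<lambda>v. of_real s * (1 / ((1 + z1 / of_real (v powr \<alpha>)) * (1 + z2 / of_real (v powr \<alpha>))))
      = of_real (v powr \<alpha>) * f_fun \<alpha> \<alpha> lam v) at_top"
    using eventually_gt_at_top[of 0] by eventually_elim (simp only: f_eq)
  ultimately have "((\<lambda>v. of_real (v powr \<alpha>) * f_fun \<alpha> \<alpha> lam v) \<longlongrightarrow> of_real s) at_top"
    by (rule Lim_transform_eventually)
  from tendsto_Re[OF this] have "((\<lambda>v. v powr \<alpha> * Re (f_fun \<alpha> \<alpha> lam v)) \<longlongrightarrow> s) at_top"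
    by simp
  then have "eventually (\<lambda>v. s / 2 < v powr \<alpha> * Re (f_fun \<alpha> \<alpha> lam v)) at_top"
    using s by (intro order_tendstoD) auto
  then obtain C where C: "\<And>v. C \<le> v \<Longrightarrow> s / 2 < v powr \<alpha> * Re (f_fun \<alpha> \<alpha> lam v)"
    unfolding eventually_at_top_linorder by blast
  have "\<not> (\<lambda>v. Re (f_fun \<alpha> \<alpha> lam v)) integrable_on {0<..}"
  proof (rule not_integrable_Ioi)
    show "0 < max C 1" "0 < s / 2" using s by auto
    fix v assume v: "max C 1 \<le> v"
    \<comment> \<open>For \<open>v \<ge> 1\<close> the decay of order
      \<open>v powr (- \<alpha>)\<close> is no faster than \<open>1 / v\<close>, so the logarithmic
      criterion applies to the real part.\<close>
    have "v powr \<alpha> \<le> v powr 1" using v \<alpha> by (intro powr_mono) auto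
    then have "s / 2 / v \<le> s / 2 / v powr \<alpha>"
      using v s by (intro divide_left_mono) auto
    also have "\<dots> \<le> Re (f_fun \<alpha> \<alpha> lam v)"
      using C[of v] v by (subst pos_divide_le_eq) (auto simp: mult.commute)
    finally show "s / 2 / v \<le> Re (f_fun \<alpha> \<alpha> lam v)" .
  qed
  moreover have "(\<lambda>v. Re (f_fun \<alpha> \<alpha> lam v)) integrable_on {0<..}"
    using integrable_linear[OF int bounded_linear_Re] by (simp add: o_def)
  ultimately show False by contradiction
qed

end

section \<open>The three cases of the theorem\<close>

theorem theorem3p4:
  fixes \<alpha> \<beta> :: real and lam :: complex
  assumes "0 < \<alpha>" and "\<alpha> < 1"
    and "0 < \<beta>" and "\<beta> < 1 + \<alpha>"
    and "lam \<noteq> 0"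
    and "- pi * \<alpha> < Arg lam" and "Arg lam < pi * \<alpha>"
  shows
    "(1 < \<beta> \<and> \<beta> < \<alpha> + 1 \<longrightarrow>
        f_fun \<alpha> \<beta> lam integrable_on {0<..} \<and>
        M1_integrand \<alpha> \<beta> lam integrable_on {0<..} \<and>
        M2_integrand \<alpha> \<beta> lam integrable_on {0<..} \<and>
        integral {0<..} (f_fun \<alpha> \<beta> lam) =
          complex_of_real (sin (\<beta> * pi) / pi) * M1 \<alpha> \<beta> lam
          + lam * complex_of_real (sin (pi * (\<alpha> - \<beta>)) / pi) * M2 \<alpha> \<beta> lam \<and>
        complex_of_real (sin (\<beta> * pi) / pi) * M1 \<alpha> \<beta> lam
          + lam * complex_of_real (sin (pi * (\<alpha> - \<beta>)) / pi) * M2 \<alpha> \<beta> lam =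
          - (lam powr complex_of_real ((1 - \<beta>) / \<alpha>) / complex_of_real \<alpha>))
     \<and> (\<beta> = 1 \<longrightarrow>
        f_fun \<alpha> \<beta> lam integrable_on {0<..} \<and>
        M2_integrand \<alpha> \<beta> lam integrable_on {0<..} \<and>
        integral {0<..} (f_fun \<alpha> \<beta> lam) =
          complex_of_real (sin (\<beta> * pi) / pi) * M1 \<alpha> \<beta> lam
          + lam * complex_of_real (sin (pi * (\<alpha> - \<beta>)) / pi) * M2 \<alpha> \<beta> lam \<and>
        complex_of_real (sin (\<beta> * pi) / pi) * M1 \<alpha> \<beta> lam
          + lam * complex_of_real (sin (pi * (\<alpha> - \<beta>)) / pi) * M2 \<alpha> \<beta> lam =
          complex_of_real (1 - 1 / \<alpha>))
     \<and> (\<beta> = \<alpha> \<longrightarrow> \<not> f_fun \<alpha> \<beta> lam integrable_on {0<..})"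
proof -
  have arg: "\<bar>Arg lam\<bar> < pi * \<alpha>" using assms by linarith
  note ctx = assms(1,2,5) arg
  let ?A = "complex_of_real (sin (\<beta> * pi) / pi)"
  let ?B = "lam * complex_of_real (sin (pi * (\<alpha> - \<beta>)) / pi)"
  have f_fun: "f_fun \<alpha> \<beta> lam = (\<lambda>v. ?A * M1_integrand \<alpha> \<beta> lam v + ?B * M2_integrand \<alpha> \<beta> lam v)"
    using f_fun_eq by blast
  show ?thesis
  proof (intro conjI[of "1 < \<beta> \<and> _ \<longrightarrow> _"] conjI[of "\<beta> = 1 \<longrightarrow> _"] impI)
    assume \<beta>: "1 < \<beta> \<and> \<beta> < \<alpha> + 1"
    \<comment> \<open>Solves \<beta> = 1 + \<alpha> * c; the range of \<beta> becomes
      \<open>0 < c < 1\<close>, and \<open>- c\<close> is the exponent of \<open>lam\<close> in the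
      claim.\<close>
    define c where "c = (\<beta> - 1) / \<alpha>"
    have c: "0 < c" "c < 1" "\<beta> = 1 + \<alpha> * c"
      using \<beta> assms(1) by (auto simp: c_def field_simps)
    obtain I1 I2 where I1: "(M1_integrand \<alpha> \<beta> lam has_integral I1) {0<..}"
      and I2: "(M2_integrand \<alpha> \<beta> lam has_integral I2) {0<..}"
      and eq: "?A * I1 + ?B * I2 = - (lam powr (- of_real c) / of_real \<alpha>)"
      using has_integral_M_integrands[OF ctx c] by blast
    have f: "(f_fun \<alpha> \<beta> lam has_integral ?A * I1 + ?B * I2) {0<..}"
      unfolding f_fun by (intro has_integral_add has_integral_mult_right I1 I2)
    have "- complex_of_real c = of_real ((1 - \<beta>) / \<alpha>)"
      unfolding c_def of_real_minus[symmetric] by (simp only: minus_divide_left minus_diff_eq)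
    moreover have "M1 \<alpha> \<beta> lam = I1" "M2 \<alpha> \<beta> lam = I2"
      using I1 I2 by (simp_all add: M1_def M2_def integral_unique)
    ultimately show "f_fun \<alpha> \<beta> lam integrable_on {0<..} \<and>
        M1_integrand \<alpha> \<beta> lam integrable_on {0<..} \<and>
        M2_integrand \<alpha> \<beta> lam integrable_on {0<..} \<and>
        integral {0<..} (f_fun \<alpha> \<beta> lam) = ?A * M1 \<alpha> \<beta> lam + ?B * M2 \<alpha> \<beta> lam \<and>
        ?A * M1 \<alpha> \<beta> lam + ?B * M2 \<alpha> \<beta> lam =
          - (lam powr complex_of_real ((1 - \<beta>) / \<alpha>) / complex_of_real \<alpha>)"
      using eq f I1 I2 has_integral_integrable integral_unique by metis
  next
    assume \<beta>: "\<beta> = 1"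
    define I where "I = complex_of_real (pi * (1 - \<alpha>)) / (of_real \<alpha> * lam * of_real (sin (pi * \<alpha>)))"
    have I: "(M2_integrand \<alpha> \<beta> lam has_integral I) {0<..}"
      unfolding I_def \<beta> by (rule has_integral_M2_integrand_1[OF ctx])
    \<comment> \<open>The factor is \<open>sin pi = 0\<close>, so the product with \<open>M1\<close>
      is 0 whatever value \<open>integral\<close> gives to \<open>M1\<close>.\<close>
    have A: "?A = 0" using \<beta> by simp
    have f: "(f_fun \<alpha> \<beta> lam has_integral ?B * I) {0<..}"
      unfolding f_fun A mult_zero_left add_0_left by (intro has_integral_mult_right I)
    have "sin (pi * (\<alpha> - \<beta>)) = - sin (pi * \<alpha>)"
      using sin_minus_pi[of "pi * \<alpha>"] \<beta> by (simp add: right_diff_distrib)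
    moreover have "0 < sin (pi * \<alpha>)" using assms by (intro sin_gt_zero) auto
    ultimately have "?B * I = complex_of_real (1 - 1 / \<alpha>)"
      using assms(1,5) by (simp add: I_def field_simps)
    moreover have "?A * M1 \<alpha> \<beta> lam + ?B * M2 \<alpha> \<beta> lam = ?B * I"
      using I unfolding A by (simp add: M2_def integral_unique)
    ultimately show "f_fun \<alpha> \<beta> lam integrable_on {0<..} \<and>
        M2_integrand \<alpha> \<beta> lam integrable_on {0<..} \<and>
        integral {0<..} (f_fun \<alpha> \<beta> lam) = ?A * M1 \<alpha> \<beta> lam + ?B * M2 \<alpha> \<beta> lam \<and>
        ?A * M1 \<alpha> \<beta> lam + ?B * M2 \<alpha> \<beta> lam = complex_of_real (1 - 1 / \<alpha>)"
      using f I has_integral_integrable integral_unique by metis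
  next
    assume "\<beta> = \<alpha>"
    then show "\<not> f_fun \<alpha> \<beta> lam integrable_on {0<..}"
      using f_fun_not_integrable[OF ctx] by simp
  qed
qed

end
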